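(* For even $s$ and odd $t$ that are coprime (positive integers), there is a bijection between the set $\mathcal{CS}_{(s,t)}$ of $(s,t)$-CSYDs and the set \[ \mathcal{NE}((t-1)/2,(s-2)/2)\cup \mathcal{NE}((t-3)/2,(s-2)/2) \] of north-east lattice paths. In addition, \[ |\mathcal{CS}_{(s,t)}|=\binom{(s-2)/2 + (t-1)/2}{(s-2)/2}+\binom{(s-2)/2 + (t-3)/2}{(s-2)/2}. \]
   Context: A strict partition $\lambda=(\lambda_1>\lambda_2>\cdots>\lambda_\ell)$ is a finite (possibly empty) strictly decreasing sequence of positive integers. The shifted Young diagram $S(\lambda)$ has boxes $(i,j)$ (row $i$, column $j$) with $1\le i\le\ell$ and $i\le j\le i+\lambda_i-1$. The shifted hook length of a box $(i,j)$ is the number of boxes consisting of the box itself, the boxes to its right in row $i$, the boxes below it in column $j$, and all boxes of row $j+1$ of $S(\lambda)$ (if that row exists). $\lambda$ is an $s$-CSYD ($s$-core shifted Young diagram) if no shifted hook length of $S(\lambda)$ is divisible by $s$. $\mathcal{CS}_{(s,t)}$ is the set of strict partitions that are both $s$-CSYDs and $t$-CSYDs (the empty partition included). $\mathcal{NE}(a,b)$ denotes the set of all lattice paths from $(0,0)$ to $(a,b)$ consisting of steps $N=(0,1)$ and $E=(1,0)$. *)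

theory Defs
  imports Main "HOL-Library.Product_Plus"
begin

definition strict_partition :: "nat list \<Rightarrow> bool" where
  "strict_partition la \<longleftrightarrow> sorted_wrt (>) la \<and> (\<forall>x\<in>set la. 0 < x)"

(* Rows and columns are numbered from 1, hence the shift in the list index. *)
definition shifted_diagram :: "nat list \<Rightarrow> (nat \<times> nat) set" where
  "shifted_diagram la =
     {(i, j). 1 \<le> i \<and> i \<le> length la \<and> i \<le> j \<and> j \<le> i + la ! (i - 1) - 1}"

definition shifted_hook_length :: "nat list \<Rightarrow> nat \<times> nat \<Rightarrow> nat" where
  "shifted_hook_length la = (\<lambda>(i, j).
     card {(k, l) \<in> shifted_diagram la.
             (k = i \<and> l = j) \<or> (k = i \<and> j < l) \<or> (i < k \<and> l = j) \<or> k = j + 1})"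

definition is_CSYD :: "nat \<Rightarrow> nat list \<Rightarrow> bool" where
  "is_CSYD s la \<longleftrightarrow> strict_partition la \<and>
     (\<forall>b \<in> shifted_diagram la. \<not> s dvd shifted_hook_length la b)"

definition CS :: "nat \<Rightarrow> nat \<Rightarrow> nat list set" where
  "CS s t = {la. is_CSYD s la \<and> is_CSYD t la}"

(* A path from the origin is given by its list of steps, so that its end point is the sum
   of the list.  The end point is integral because (t - 3)/2 is negative for t = 1; there
   are then no paths. *)
definition NE :: "int \<Rightarrow> int \<Rightarrow> (int \<times> int) list set" where
  "NE a b = {p. set p \<subseteq> {(0, 1), (1, 0)} \<and> sum_list p = (a, b)}"

(* Binomial coefficient with the combinatorial convention that it vanishes for a negative
   upper argument.  This matters only for (-1 over 0), which occurs for s = 2 and t = 1;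
   the polynomial convention (gchoose) would give 1 there, although there are no paths
   to (-1, 0). *)
definition binom :: "int \<Rightarrow> int \<Rightarrow> nat" where
  "binom n k = (if 0 \<le> k \<and> k \<le> n then nat n choose nat k else 0)"

end

theory Submission
  imports Defs
begin

text \<open>
A shifted diagram has a simple description of its hooks: the row of a part \<open>x\<close> has the hook
lengths \<open>x + z\<close> for the parts \<open>z < x\<close> and \<open>x - y\<close> for the numbers \<open>0 \<le> y < x\<close> that are not
parts (\<open>row_hook_lengths\<close>). Hence a strict partition is an \<open>s\<close>-core exactly if its set \<open>P\<close> of
parts contains no multiple of \<open>s\<close>, is closed under subtracting \<open>s\<close> as long as the result is
positive, and contains no two distinct parts whose sum is divisible by \<open>s\<close>
(\<open>is_CSYD_iff_core_set\<close>).

Write \<open>s = 2n + 2\<close>, \<open>t = 2m + 1\<close> and \<open>h = s/2\<close>, and give the box \<open>(i, b)\<close> the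
value \<open>v = i t - s b\<close>. If \<open>m > 0\<close>, every part other than \<open>h\<close> of a simultaneous core is
\<open>v\<close> or \<open>-v\<close> for a unique box of the rectangle \<open>{1..n} \<times> {1..m}\<close>: the residues \<open>0\<close> and \<open>h\<close>
modulo \<open>s\<close> are excluded, and the remaining ones are \<open>\<plusminus> i t\<close> with \<open>1 \<le> i \<le> n\<close>. Extend the set of
parts to negative numbers by the rule that \<open>-x\<close> is a member exactly if \<open>x\<close> is not. The core
conditions then say that membership is inherited from \<open>v\<close> by \<open>v - s\<close> and \<open>v - t\<close>, so that
the boxes whose value is a member form a set \<open>D\<close> closed under decreasing \<open>i\<close> and
increasing \<open>b\<close>. Conversely, each such order ideal \<open>D\<close> comes from a simultaneous core without the
part \<open>h\<close>. The part \<open>h\<close> may be added exactly if \<open>D\<close> contains the whole row \<open>b = m\<close>, because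
\<open>h - v(i, m)\<close> is a multiple of \<open>t\<close>; such \<open>D\<close> amount to the order ideals of
\<open>{1..n} \<times> {1..m - 1}\<close>.

Order ideals of a rectangle and lattice paths both satisfy Pascal's recursion, which gives the
two binomial coefficients and, by comparing cardinalities, the bijection. If \<open>t = 1\<close>, the only
core is the empty partition and the second set of paths is empty.
\<close>

section \<open>Shifted hook lengths\<close>

lemma strict_partition_nth_less:
  assumes "strict_partition la" "r < r'" "r' < length la"
  shows "la ! r' < la ! r"
  using assms sorted_wrt_nth_less[of "(>)" la r r'] unfolding strict_partition_def by auto

lemma strict_partition_nth_pos:
  assumes "strict_partition la" "r < length la"
  shows "0 < la ! r"
  using assms unfolding strict_partition_def by auto

text \<open>
The right ends of the rows of a shifted diagram weakly recede from top to bottom; a column is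
therefore an initial segment of rows.
\<close>

lemma strict_partition_nth_add_le:
  assumes "strict_partition la" "r \<le> r'" "r' < length la"
  shows "la ! r' + r' \<le> la ! r + r"
  using assms(2,3)
proof (induction r' rule: dec_induct)
  case (step k)
  then show ?case
    using strict_partition_nth_less[OF assms(1), of k "Suc k"] by simp
qed simp

lemma shifted_diagram_mem:
  assumes "strict_partition la"
  shows "(i, j) \<in> shifted_diagram la \<longleftrightarrow>
    1 \<le> i \<and> i \<le> length la \<and> i \<le> j \<and> j < i + la ! (i - 1)"
proof (cases "1 \<le> i \<and> i \<le> length la")
  case True
  then have "0 < la ! (i - 1)"
    using strict_partition_nth_pos[OF assms, of "i - 1"] by linarith
  then show ?thesis
    unfolding shifted_diagram_def by auto
qed (auto simp: shifted_diagram_def)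

lemma shifted_hook_length_eq:
  assumes la: "strict_partition la" and ij: "(i, j) \<in> shifted_diagram la"
  shows "shifted_hook_length la (i, j) = (i + la ! (i - 1) - j) +
     card {k \<in> {i<..length la}. k \<le> j \<and> j < k + la ! (k - 1)} +
     (if j < length la then la ! j else 0)"
proof -
  let ?A = "Pair i ` {j..<i + la ! (i - 1)}"
  let ?C = "{k \<in> {i<..length la}. k \<le> j \<and> j < k + la ! (k - 1)}"
  let ?B = "(\<lambda>k. (k, j)) ` ?C"
  let ?R = "if j < length la then Pair (Suc j) ` {Suc j..<Suc j + la ! j} else {}"
  have i: "1 \<le> i" "i \<le> length la" "i \<le> j"
    using ij by (auto simp: shifted_diagram_mem[OF la])
  have "{(k, l) \<in> shifted_diagram la.
      (k = i \<and> l = j) \<or> (k = i \<and> j < l) \<or> (i < k \<and> l = j) \<or> k = j + 1} = ?A \<union> ?B \<union> ?R"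
    (is "?L = _")
  proof (rule set_eqI)
    fix b :: "nat \<times> nat"
    obtain k l where b: "b = (k, l)" by (cases b)
    show "b \<in> ?L \<longleftrightarrow> b \<in> ?A \<union> ?B \<union> ?R"
      unfolding b using i by (auto simp: shifted_diagram_mem[OF la] image_iff)
  qed
  moreover have "finite ?C" by simp
  moreover have "?A \<inter> ?B = {}" "(?A \<union> ?B) \<inter> ?R = {}"
    using i by auto
  moreover have "card ?A = i + la ! (i - 1) - j" "card ?B = card ?C"
    "card ?R = (if j < length la then la ! j else 0)" "finite ?R"
    by (auto simp: card_image inj_on_def)
  ultimately show ?thesis
    unfolding shifted_hook_length_def
    by (simp add: card_Un_disjoint del: Un_iff)
qed

text \<open>
A column \<open>j\<close> with \<open>i \<le> j < length la\<close> meets row \<open>i\<close> and every later row down to row \<open>j\<close>; these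
\<open>j - i\<close> boxes below make up exactly for the boxes of row \<open>i\<close> to the left of column \<open>j\<close>.
\<close>

lemma shifted_hook_length_within:
  assumes la: "strict_partition la" and i: "1 \<le> i" "i \<le> j" "j < length la"
  shows "(i, j) \<in> shifted_diagram la"
    and "shifted_hook_length la (i, j) = la ! (i - 1) + la ! j"
proof -
  have less: "j < k + la ! (k - 1)" if "1 \<le> k" "k \<le> j" for k
    using strict_partition_nth_add_le[OF la, of "k - 1" j] strict_partition_nth_pos[OF la, of j]
      i that by linarith
  then show ij: "(i, j) \<in> shifted_diagram la"
    using i by (simp add: shifted_diagram_mem[OF la])
  have "{k \<in> {i<..length la}. k \<le> j \<and> j < k + la ! (k - 1)} = {i<..j}"
    using less i by auto
  then show "shifted_hook_length la (i, j) = la ! (i - 1) + la ! j"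
    using i less[of i] by (simp add: shifted_hook_length_eq[OF la ij])
qed

lemma shifted_hook_length_beyond:
  assumes la: "strict_partition la" and i: "1 \<le> i" "i \<le> length la"
    and j: "length la \<le> j" "j < i + la ! (i - 1)"
  shows "shifted_hook_length la (i, j) = (i + la ! (i - 1) - j) +
     card {k \<in> {i<..length la}. j < k + la ! (k - 1)}"
proof -
  have "(i, j) \<in> shifted_diagram la"
    using i j by (simp add: shifted_diagram_mem[OF la])
  moreover have "{k \<in> {i<..length la}. k \<le> j \<and> j < k + la ! (k - 1)} =
      {k \<in> {i<..length la}. j < k + la ! (k - 1)}"
    using j by auto
  ultimately show ?thesis
    using j by (simp add: shifted_hook_length_eq[OF la])
qed

lemma parts_less_nth:
  assumes "strict_partition la" "r < length la"
  shows "set la \<inter> {..<la ! r} = (!) la ` {r<..<length la}"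
    and "card (set la \<inter> {..<la ! r}) = length la - Suc r"
proof -
  have less: "la ! r' < la ! r \<longleftrightarrow> r < r'" if "r' < length la" for r'
    using strict_partition_nth_less[OF assms(1), of r r'] that assms(2)
      strict_partition_nth_less[OF assms(1), of r' r] by (cases r r' rule: linorder_cases) auto
  show eq: "set la \<inter> {..<la ! r} = (!) la ` {r<..<length la}"
    using less by (force simp: in_set_conv_nth)
  have "inj_on ((!) la) {r<..<length la}"
    using strict_partition_nth_less[OF assms(1)]
    by (intro linorder_inj_onI) force+
  then show "card (set la \<inter> {..<la ! r}) = length la - Suc r"
    unfolding eq by (simp add: card_image)
qed

text \<open>
In the columns to the right of the last diagonal box, let \<open>c\<close> be the number of boxes below
\<open>(i, j)\<close>. The hook length is \<open>x - y\<close> with \<open>y = j - i - c\<close>. If \<open>y\<close> were a part, say of row \<open>r\<close>,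
then row \<open>r\<close> reaches column \<open>j\<close> if and only if \<open>r > i + c\<close>, whereas the rows below row \<open>i\<close> that
reach column \<open>j\<close> are those up to \<open>i + c\<close>. This shows one inclusion; equality follows by
counting, since the hook lengths strictly decrease along the row.
\<close>

lemma row_hook_lengths_beyond:
  assumes la: "strict_partition la" and i: "1 \<le> i" "i \<le> length la"
  defines "x \<equiv> la ! (i - 1)"
  shows "(\<lambda>j. shifted_hook_length la (i, j)) ` {length la..<i + x} =
     (\<lambda>y. x - y) ` ({..<x} - set la)"
proof (rule card_subset_eq)
  define C where "C j = {k \<in> {i<..length la}. j < k + la ! (k - 1)}" for j
  have hook: "shifted_hook_length la (i, j) = (i + x - j) + card (C j)"
    if "length la \<le> j" "j < i + x" for j
    unfolding C_def x_def using shifted_hook_length_beyond[OF la i] that unfolding x_def by blast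
  show "finite ((\<lambda>y. x - y) ` ({..<x} - set la))"
    by simp
  show "(\<lambda>j. shifted_hook_length la (i, j)) ` {length la..<i + x} \<subseteq>
      (\<lambda>y. x - y) ` ({..<x} - set la)"
  proof safe
    fix j assume "j \<in> {length la..<i + x}"
    then have j: "length la \<le> j" "j < i + x" by auto
    have "C j \<subseteq> {i<..length la}" unfolding C_def by auto
    then have card_le: "card (C j) \<le> length la - i"
      using card_mono[of "{i<..length la}" "C j"] by simp
    define y where "y = j - i - card (C j)"
    have h: "shifted_hook_length la (i, j) = x - y"
      using hook[OF j] card_le i j unfolding y_def by linarith
    have "y < x" using j i unfolding y_def by linarith
    moreover have "y \<notin> set la"
    proof
      assume "y \<in> set la"
      then obtain r where r: "r < length la" "y = la ! r"
        by (auto simp: in_set_conv_nth)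
      have "i - 1 < length la" using i by simp
      then have "i - 1 < r"
        using strict_partition_nth_less[OF la, of r "i - 1"] r \<open>y < x\<close> unfolding x_def
        by (cases r "i - 1" rule: linorder_cases) auto
      (* Row Suc r, the row of the part y, reaches column j iff j < Suc r + y. *)
      show False
      proof (cases "j < Suc r + y")
        case True
        have "{i<..Suc r} \<subseteq> C j"
        proof
          fix k assume k: "k \<in> {i<..Suc r}"
          then have "la ! r + r \<le> la ! (k - 1) + (k - 1)"
            using r by (intro strict_partition_nth_add_le[OF la]) auto
          then show "k \<in> C j"
            using k r True unfolding C_def by auto
        qed
        then have "card {i<..Suc r} \<le> card (C j)"
          by (intro card_mono) (auto simp: C_def)
        then show False
          using True \<open>i - 1 < r\<close> j i card_le unfolding y_def by simp
      next
        case False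
        have "C j \<subseteq> {i<..r}"
        proof
          fix k assume k: "k \<in> C j"
          have "\<not> Suc r \<le> k"
            using strict_partition_nth_add_le[OF la, of r "k - 1"] k r False
            unfolding C_def by fastforce
          then show "k \<in> {i<..r}"
            using k unfolding C_def by auto
        qed
        then have "card (C j) \<le> card {i<..r}"
          by (intro card_mono) auto
        then show False
          using False \<open>i - 1 < r\<close> j i card_le unfolding y_def by simp
      qed
    qed
    ultimately show "shifted_hook_length la (i, j) \<in> (\<lambda>y. x - y) ` ({..<x} - set la)"
      using h by blast
  qed
  have "inj_on (\<lambda>j. shifted_hook_length la (i, j)) {length la..<i + x}"
  proof (rule linorder_inj_onI)
    fix j j' assume jj': "j < j'" "j \<in> {length la..<i + x}" "j' \<in> {length la..<i + x}"
    have "card (C j') \<le> card (C j)"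
      using jj' by (intro card_mono) (auto simp: C_def)
    then show "shifted_hook_length la (i, j) \<noteq> shifted_hook_length la (i, j')"
      using jj' hook[of j] hook[of j'] by auto
  qed auto
  then have "card ((\<lambda>j. shifted_hook_length la (i, j)) ` {length la..<i + x}) = i + x - length la"
    by (simp add: card_image)
  also have "\<dots> = card ({..<x} - set la)"
  proof -
    have "card ({..<x} - set la) = x - card (set la \<inter> {..<x})"
      by (metis Diff_Int_distrib card_Diff_subset_Int card_lessThan finite_Int finite_lessThan inf_commute)
    moreover have "i - 1 < length la" using i by simp
    moreover have "card (set la \<inter> {..<x}) \<le> x"
      using card_mono[of "{..<x}" "set la \<inter> {..<x}"] by simp
    ultimately show ?thesis
      using parts_less_nth(2)[OF la, of "i - 1"] i unfolding x_def by (simp add: add.commute)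
  qed
  also have "\<dots> = card ((\<lambda>y. x - y) ` ({..<x} - set la))"
    by (rule card_image[symmetric]) (auto simp: inj_on_def)
  finally show "card ((\<lambda>j. shifted_hook_length la (i, j)) ` {length la..<i + x}) =
      card ((\<lambda>y. x - y) ` ({..<x} - set la))" .
qed

lemma row_hook_lengths:
  assumes la: "strict_partition la" and i: "1 \<le> i" "i \<le> length la"
  defines "x \<equiv> la ! (i - 1)"
  shows "(\<lambda>j. shifted_hook_length la (i, j)) ` {j. (i, j) \<in> shifted_diagram la} =
     (\<lambda>z. x + z) ` (set la \<inter> {..<x}) \<union> (\<lambda>y. x - y) ` ({..<x} - set la)"
proof -
  have "length la - 1 + la ! (length la - 1) \<le> i - 1 + x"
    using strict_partition_nth_add_le[OF la, of "i - 1" "length la - 1"] i unfolding x_def by linarith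
  then have "length la \<le> i + x"
    using strict_partition_nth_pos[OF la, of "length la - 1"] i by linarith
  then have cols: "{j. (i, j) \<in> shifted_diagram la} = {i..<length la} \<union> {length la..<i + x}"
    using i by (auto simp: shifted_diagram_mem[OF la] x_def)
  have "(\<lambda>j. shifted_hook_length la (i, j)) ` {i..<length la} = (\<lambda>j. x + la ! j) ` {i..<length la}"
    using shifted_hook_length_within(2)[OF la] i unfolding x_def by (intro image_cong) auto
  also have "\<dots> = (\<lambda>z. x + z) ` ((!) la ` {i..<length la})"
    by (simp add: image_image)
  also have "(!) la ` {i..<length la} = set la \<inter> {..<x}"
  proof -
    have "{i..<length la} = {i - 1<..<length la}" using i by auto
    moreover have "i - 1 < length la" using i by simp
    ultimately show ?thesis
      using parts_less_nth(1)[OF la] unfolding x_def by metis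
  qed
  finally show ?thesis
    unfolding cols image_Un using row_hook_lengths_beyond[OF la i] unfolding x_def by simp
qed

lemma is_CSYD_iff_parts:
  "is_CSYD s la \<longleftrightarrow> strict_partition la \<and>
     (\<forall>x\<in>set la. (\<forall>z\<in>set la. z < x \<longrightarrow> \<not> s dvd x + z) \<and>
                 (\<forall>y<x. y \<notin> set la \<longrightarrow> \<not> s dvd x - y))"
proof (cases "strict_partition la")
  case True
  have "(\<forall>b\<in>shifted_diagram la. \<not> s dvd shifted_hook_length la b) \<longleftrightarrow>
     (\<forall>i\<in>{1..length la}. \<forall>h \<in> (\<lambda>j. shifted_hook_length la (i, j)) ` {j. (i, j) \<in> shifted_diagram la}.
        \<not> s dvd h)"
    by (auto simp: shifted_diagram_def)
  also have "\<dots> \<longleftrightarrow> (\<forall>i\<in>{1..length la}. let x = la ! (i - 1) in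
      (\<forall>z\<in>set la. z < x \<longrightarrow> \<not> s dvd x + z) \<and> (\<forall>y<x. y \<notin> set la \<longrightarrow> \<not> s dvd x - y))"
    using row_hook_lengths[OF True] by (intro ball_cong refl) (auto simp: Let_def)
  also have "\<dots> \<longleftrightarrow> (\<forall>x\<in>(\<lambda>i. la ! (i - 1)) ` {1..length la}.
      (\<forall>z\<in>set la. z < x \<longrightarrow> \<not> s dvd x + z) \<and> (\<forall>y<x. y \<notin> set la \<longrightarrow> \<not> s dvd x - y))"
    by (simp add: Let_def)
  also have "(\<lambda>i. la ! (i - 1)) ` {1..length la} = set la"
  proof -
    have "{1..length la} = Suc ` {..<length la}"
      by (simp add: lessThan_atLeast0 atLeastLessThanSuc_atLeastAtMost)
    then show ?thesis by (auto simp: image_image set_conv_nth)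
  qed
  finally show ?thesis
    using True unfolding is_CSYD_def by simp
qed (simp add: is_CSYD_def)

section \<open>Cores as sets of integers\<close>

text \<open>
The \<open>s\<close>-core condition on a set of parts. Parts are taken as integers because they are
compared with signed values \<open>i * t - s * b\<close> below.
\<close>

definition core_set :: "int \<Rightarrow> int set \<Rightarrow> bool" where
  "core_set s P \<longleftrightarrow> (\<forall>x\<in>P. 0 < x \<and> \<not> s dvd x \<and> (s < x \<longrightarrow> x - s \<in> P)) \<and>
     (\<forall>x\<in>P. \<forall>y\<in>P. x \<noteq> y \<longrightarrow> \<not> s dvd x + y)"

lemma core_setD:
  assumes "core_set s P" "x \<in> P"
  shows "0 < x" "\<not> s dvd x" "y \<in> P \<Longrightarrow> x \<noteq> y \<Longrightarrow> \<not> s dvd x + y"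
  using assms unfolding core_set_def by auto

lemma core_set_diff_multiple:
  assumes P: "core_set s P" and "0 < s" "x \<in> P" "0 \<le> k" "s * k < x"
  shows "x - s * k \<in> P"
  using assms(4,5)
proof (induction k rule: int_ge_induct)
  case base
  then show ?case using \<open>x \<in> P\<close> by simp
next
  case (step k)
  then have "s < x - s * k" by (simp add: algebra_simps)
  moreover have "x - s * k \<in> P"
    using step \<open>0 < s\<close> by (simp add: algebra_simps)
  ultimately have "x - s * k - s \<in> P"
    using P unfolding core_set_def by blast
  then show ?case by (simp add: algebra_simps)
qed

text \<open>
By the description of the hook lengths in a row, a hook length \<open>x - y\<close> divisible by \<open>s\<close> is a
missing number \<open>y\<close> in the chain \<open>x, x - s, x - 2s, \<dots>\<close>. The case \<open>y = 0\<close> accounts for the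
condition that no part is a multiple of \<open>s\<close>.
\<close>

lemma is_CSYD_iff_core_set:
  assumes "0 < s"
  shows "is_CSYD s la \<longleftrightarrow> strict_partition la \<and> core_set (int s) (int ` set la)"
proof (cases "strict_partition la")
  case True
  let ?P = "int ` set la"
  have pos: "0 < x" if "x \<in> set la" for x
    using True that unfolding strict_partition_def by blast
  have "core_set (int s) ?P" if hooks:
    "\<forall>x\<in>set la. (\<forall>z\<in>set la. z < x \<longrightarrow> \<not> s dvd x + z) \<and> (\<forall>y<x. y \<notin> set la \<longrightarrow> \<not> s dvd x - y)"
  proof -
    have "\<not> int s dvd int x" "int s < int x \<longrightarrow> int x - int s \<in> ?P" if "x \<in> set la" for x
    proof -
      have "0 \<notin> set la" using pos by blast
      then have "\<not> s dvd x - 0"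
        using hooks that pos[OF that] by blast
      then show "\<not> int s dvd int x" by simp
      show "int s < int x \<longrightarrow> int x - int s \<in> ?P"
      proof
        assume "int s < int x"
        then have "x - s \<in> set la"
          using hooks that \<open>0 < s\<close> by (metis diff_diff_cancel diff_less dvd_refl less_imp_le of_nat_less_iff pos)
        then show "int x - int s \<in> ?P"
          using \<open>int s < int x\<close> by (auto simp: image_iff intro!: bexI[of _ "x - s"])
      qed
    qed
    moreover have "\<not> int s dvd int x + int y" if "x \<in> set la" "y \<in> set la" "x \<noteq> y" for x y
    proof -
      have "\<not> s dvd x + y"
        using hooks that by (metis add.commute linorder_neq_iff)
      then show ?thesis by (metis int_dvd_int_iff of_nat_add)
    qed
    ultimately show ?thesis
      using pos unfolding core_set_def by auto
  qed
  moreover have "(\<forall>z\<in>set la. z < x \<longrightarrow> \<not> s dvd x + z) \<and> (\<forall>y<x. y \<notin> set la \<longrightarrow> \<not> s dvd x - y)"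
    if P: "core_set (int s) ?P" and x: "x \<in> set la" for x
  proof (intro conjI ballI allI impI notI)
    fix z assume "z \<in> set la" "z < x" "s dvd x + z"
    then have "int s dvd int x + int z"
      by (metis int_dvd_int_iff of_nat_add)
    then show False
      using core_setD(3)[OF P, of "int x" "int z"] x \<open>z \<in> set la\<close> \<open>z < x\<close> by auto
  next
    fix y assume y: "y < x" "y \<notin> set la" "s dvd x - y"
    then obtain k where k: "x - y = s * k" by blast
    then have eq: "int x - int s * int k = int y"
      using y by (metis add_diff_cancel_right' le_add_diff_inverse2 less_imp_le of_nat_add of_nat_mult
          add.commute)
    show False
    proof (cases "y = 0")
      case True
      then show False
        using core_setD(2)[OF P, of "int x"] x k by auto
    next
      case False
      then have "int y \<in> ?P"
        using core_set_diff_multiple[OF P, of "int x" "int k"] x eq \<open>0 < s\<close> by auto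
      then show False using y by auto
    qed
  qed
  ultimately show ?thesis
    using True unfolding is_CSYD_iff_parts by blast
qed (simp add: is_CSYD_def)

lemma card_CS_eq_card_core_sets:
  assumes "0 < s" "0 < t"
    and fin: "\<And>P. core_set (int s) P \<Longrightarrow> core_set (int t) P \<Longrightarrow> finite P"
  shows "card (CS s t) = card {P. core_set (int s) P \<and> core_set (int t) P}"
proof (rule bij_betw_same_card)
  show "bij_betw (\<lambda>la. int ` set la) (CS s t) {P. core_set (int s) P \<and> core_set (int t) P}"
    unfolding bij_betw_def
  proof
    show "inj_on (\<lambda>la. int ` set la) (CS s t)"
    proof (rule inj_onI)
      fix la mu assume "la \<in> CS s t" "mu \<in> CS s t" and eq: "int ` set la = int ` set mu"
      then have "sorted_wrt (<) (rev la)" "sorted_wrt (<) (rev mu)"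
        unfolding CS_def is_CSYD_def strict_partition_def by (auto simp: sorted_wrt_rev)
      moreover have "set (rev la) = set (rev mu)"
        using eq by (simp add: inj_image_eq_iff)
      ultimately have "rev la = rev mu"
        by (metis strict_sorted_equal)
      then show "la = mu" by simp
    qed
    show "(\<lambda>la. int ` set la) ` CS s t = {P. core_set (int s) P \<and> core_set (int t) P}"
    proof (intro equalityI subsetI)
      fix P assume "P \<in> (\<lambda>la. int ` set la) ` CS s t"
      then show "P \<in> {P. core_set (int s) P \<and> core_set (int t) P}"
        using assms unfolding CS_def by (auto simp: is_CSYD_iff_core_set)
    next
      fix P assume "P \<in> {P. core_set (int s) P \<and> core_set (int t) P}"
      then have P: "core_set (int s) P" "core_set (int t) P" by auto
      have pos: "0 < x" if "x \<in> P" for x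
        using core_setD(1)[OF P(1) that] .
      define la where "la = rev (sorted_list_of_set (nat ` P))"
      have set: "set la = nat ` P"
        using fin[OF P] unfolding la_def by simp
      have P_eq: "int ` set la = P"
        using pos unfolding set by (force simp: image_image)
      have "sorted_wrt (>) la"
        unfolding la_def by (simp add: sorted_wrt_rev)
      then have "strict_partition la"
        using pos unfolding strict_partition_def set by auto
      then have "la \<in> CS s t"
        using P P_eq assms unfolding CS_def by (simp add: is_CSYD_iff_core_set)
      then show "P \<in> (\<lambda>la. int ` set la) ` CS s t"
        using P_eq by blast
    qed
  qed
qed

lemma core_set_1_iff: "core_set 1 P \<longleftrightarrow> P = {}"
proof
  assume P: "core_set 1 P"
  show "P = {}"
    using core_setD(2)[OF P] by (meson equals0I one_dvd)
qed (simp add: core_set_def)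


section \<open>Order ideals of a rectangle\<close>

text \<open>
The order is the one in which \<open>(i, b)\<close> is above \<open>(i', b')\<close> if \<open>i' \<le> i\<close> and \<open>b \<le> b'\<close>, that is,
the componentwise order with the second coordinate reversed; this matches the values
\<open>i * t - s * b\<close>, which increase in \<open>i\<close> and decrease in \<open>b\<close>.
\<close>

definition ideals :: "nat \<Rightarrow> nat \<Rightarrow> (int \<times> int) set set" where
  "ideals n m = {D. D \<subseteq> {1..int n} \<times> {1..int m} \<and>
     (\<forall>i b i' b'. (i, b) \<in> D \<and> 1 \<le> i' \<and> i' \<le> i \<and> b \<le> b' \<and> b' \<le> int m \<longrightarrow> (i', b') \<in> D)}"

lemma finite_ideals: "finite (ideals n m)"
  by (rule finite_subset[of _ "Pow ({1..int n} \<times> {1..int m})"]) (auto simp: ideals_def)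

lemma ideals_subset: "D \<in> ideals n m \<Longrightarrow> D \<subseteq> {1..int n} \<times> {1..int m}"
  by (simp add: ideals_def)

lemma ideals_closed:
  "D \<in> ideals n m \<Longrightarrow> (i, b) \<in> D \<Longrightarrow> 1 \<le> i' \<Longrightarrow> i' \<le> i \<Longrightarrow> b \<le> b' \<Longrightarrow> b' \<le> int m \<Longrightarrow> (i', b') \<in> D"
  unfolding ideals_def by blast

lemma idealsI:
  assumes "D \<subseteq> {1..int n} \<times> {1..int m}"
    and "\<And>i b i' b'. (i, b) \<in> D \<Longrightarrow> 1 \<le> i' \<Longrightarrow> i' \<le> i \<Longrightarrow> b \<le> b' \<Longrightarrow> b' \<le> int m \<Longrightarrow> (i', b') \<in> D"
  shows "D \<in> ideals n m"
  using assms unfolding ideals_def by blast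

text \<open>
The full row \<open>b = m + 1\<close> carries no information, and removing it leaves an arbitrary order
ideal of the smaller rectangle.
\<close>

lemma card_ideals_with_full_row:
  "card {D \<in> ideals n (Suc m). {1..int n} \<times> {int (Suc m)} \<subseteq> D} = card (ideals n m)"
proof (rule bij_betw_same_card)
  let ?R = "{1..int n} \<times> {1..int m}" and ?row = "{1..int n} \<times> {int (Suc m)}"
  show "bij_betw (\<lambda>D. D \<inter> ?R) {D \<in> ideals n (Suc m). ?row \<subseteq> D} (ideals n m)"
  proof (rule bij_betw_byWitness[where f' = "\<lambda>D. D \<union> ?row"])
    show "\<forall>D\<in>{D \<in> ideals n (Suc m). ?row \<subseteq> D}. D \<inter> ?R \<union> ?row = D"
      by (auto dest!: ideals_subset)
    show "\<forall>D\<in>ideals n m. (D \<union> ?row) \<inter> ?R = D"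
      by (auto dest!: ideals_subset)
    show "(\<lambda>D. D \<inter> ?R) ` {D \<in> ideals n (Suc m). ?row \<subseteq> D} \<subseteq> ideals n m"
    proof (clarify, rule idealsI)
      fix D i b i' b'
      assume D: "D \<in> ideals n (Suc m)" and ib: "(i, b) \<in> D \<inter> ?R"
        and le: "1 \<le> i'" "i' \<le> i" "b \<le> b'" "b' \<le> int m"
      show "(i', b') \<in> D \<inter> ?R"
        using ideals_closed[OF D, of i b i' b'] ib le by auto
    qed auto
    show "(\<lambda>D. D \<union> ?row) ` ideals n m \<subseteq> {D \<in> ideals n (Suc m). ?row \<subseteq> D}"
    proof (clarify, intro conjI idealsI)
      fix D i b i' b'
      assume D: "D \<in> ideals n m" and ib: "(i, b) \<in> D \<union> ?row"
        and le: "1 \<le> i'" "i' \<le> i" "b \<le> b'" "b' \<le> int (Suc m)"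
      show "(i', b') \<in> D \<union> ?row"
        using ideals_closed[OF D, of i b i' b'] ideals_subset[OF D] ib le
        by (cases "b' \<le> int m") auto
    qed (auto dest!: ideals_subset)
  qed
qed

text \<open>
Whether an ideal contains the corner \<open>(n + 1, m + 1)\<close> decides which smaller rectangle it lives
in. The corner lies below every box of the column \<open>i = n + 1\<close>, so that an ideal without it has
no box in that column.
\<close>

lemma ideals_without_corner:
  "{D \<in> ideals (Suc n) (Suc m). (int (Suc n), int (Suc m)) \<notin> D} = ideals n (Suc m)"
proof (intro set_eqI iffI)
  fix D assume "D \<in> {D \<in> ideals (Suc n) (Suc m). (int (Suc n), int (Suc m)) \<notin> D}"
  then have D: "D \<in> ideals (Suc n) (Suc m)" and corner: "(int (Suc n), int (Suc m)) \<notin> D" by auto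
  have "i \<noteq> int (Suc n)" if "(i, b) \<in> D" for i b
    using ideals_closed[OF D that, of "int (Suc n)" "int (Suc m)"] ideals_subset[OF D] that corner
    by auto
  with ideals_subset[OF D] have "D \<subseteq> {1..int n} \<times> {1..int (Suc m)}"
    by force
  then show "D \<in> ideals n (Suc m)"
    by (rule idealsI) (rule ideals_closed[OF D])
next
  fix D assume D: "D \<in> ideals n (Suc m)"
  then have "D \<in> ideals (Suc n) (Suc m)"
    using ideals_subset[OF D] ideals_closed[OF D] by (intro idealsI) force+
  then show "D \<in> {D \<in> ideals (Suc n) (Suc m). (int (Suc n), int (Suc m)) \<notin> D}"
    using ideals_subset[OF D] by auto
qed

text \<open>
The corner lies above every box of the row \<open>b = m + 1\<close>.
\<close>

lemma ideals_with_corner: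
  "{D \<in> ideals (Suc n) (Suc m). (int (Suc n), int (Suc m)) \<in> D} =
   {D \<in> ideals (Suc n) (Suc m). {1..int (Suc n)} \<times> {int (Suc m)} \<subseteq> D}"
proof -
  have "{1..int (Suc n)} \<times> {int (Suc m)} \<subseteq> D \<longleftrightarrow> (int (Suc n), int (Suc m)) \<in> D"
    if D: "D \<in> ideals (Suc n) (Suc m)" for D
  proof
    assume "(int (Suc n), int (Suc m)) \<in> D"
    from ideals_closed[OF D this] show "{1..int (Suc n)} \<times> {int (Suc m)} \<subseteq> D"
      by auto
  qed auto
  then show ?thesis by blast
qed

lemma ideals_empty_rectangle:
  assumes "n = 0 \<or> m = 0"
  shows "ideals n m = {{}}"
proof -
  have "{1..int n} \<times> {1..int m} = {}" using assms by auto
  then have "D = {}" if "D \<in> ideals n m" for D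
    using ideals_subset[OF that] by (metis subset_empty)
  moreover have "{} \<in> ideals n m" by (rule idealsI) auto
  ultimately show ?thesis by blast
qed

lemma card_ideals: "card (ideals n m) = (n + m) choose n"
proof (induction "n + m" arbitrary: n m)
  case 0
  then have "n = 0" "m = 0" by auto
  then show ?case by (simp add: ideals_empty_rectangle)
next
  case (Suc k)
  show ?case
  proof (cases "n = 0 \<or> m = 0")
    case True
    then show ?thesis by (auto simp: ideals_empty_rectangle)
  next
    case False
    then obtain n' m' where nm: "n = Suc n'" "m = Suc m'"
      by (metis not0_implies_Suc)
    have "ideals n m = {D \<in> ideals n m. (int n, int m) \<notin> D} \<union> {D \<in> ideals n m. (int n, int m) \<in> D}"
      by blast
    then have "card (ideals n m) =
        card {D \<in> ideals n m. (int n, int m) \<notin> D} + card {D \<in> ideals n m. (int n, int m) \<in> D}"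
      using finite_ideals[of n m] card_Un_disjoint[of "{D \<in> ideals n m. (int n, int m) \<notin> D}"
          "{D \<in> ideals n m. (int n, int m) \<in> D}"] by auto
    also have "\<dots> = card (ideals n' m) + card (ideals n m')"
      unfolding nm ideals_without_corner ideals_with_corner card_ideals_with_full_row ..
    also have "\<dots> = ((n' + m) choose n') + ((n + m') choose n)"
      using Suc(1)[of n' m] Suc(1)[of n m'] Suc(2) nm by simp
    finally show ?thesis
      unfolding nm by simp
  qed
qed


section \<open>Simultaneous cores and order ideals\<close>

text \<open>
In the notation of the introduction. The case \<open>m = 0\<close>, that is \<open>t = 1\<close>, is left out because
\<open>h\<close> is then a multiple of \<open>t\<close> and cannot be a part.
\<close>

locale coprime_even_odd =
  fixes n m :: nat and s t :: int
  assumes s_eq: "s = 2 * int n + 2" and t_eq: "t = 2 * int m + 1" and m_pos: "0 < m"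
    and coprime: "coprime s t"
begin

definition h :: int where "h = int n + 1"

definition val :: "int \<Rightarrow> int \<Rightarrow> int" where "val i b = i * t - s * b"

abbreviation R :: "(int \<times> int) set" where "R \<equiv> {1..int n} \<times> {1..int m}"

lemma s_eq_2h: "s = 2 * h" by (simp add: s_eq h_def)

lemma s_pos: "0 < s" and t_pos: "0 < t" and h_pos: "0 < h"
  by (auto simp: s_eq t_eq h_def)

lemma s_dvd_mult_t: "s dvd i * t \<longleftrightarrow> s dvd i"
  using coprime by (simp add: coprime_dvd_mult_left_iff)

lemma t_dvd_s_mult: "t dvd s * b \<longleftrightarrow> t dvd b"
  using coprime by (simp add: coprime_dvd_mult_right_iff coprime_commute)

lemma not_dvd_between: "0 < k \<Longrightarrow> k < (d::int) \<Longrightarrow> \<not> d dvd k"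
  by (rule zdvd_not_zless)

lemma eq_if_dvd_diff:
  assumes "(d::int) dvd x - y" "x - y < d" "y - x < d"
  shows "x = y"
  using assms by (metis dvd_diff_commute diff_gt_0_iff_gt linorder_neq_iff zdvd_not_zless)

lemma val_diff: "val i b - s * k = val i (b + k)" "val i b - t * k = val (i - k) b"
  by (auto simp: val_def algebra_simps)

text \<open>
The value of a box modulo \<open>s\<close> depends on its column \<open>i\<close> only, and modulo \<open>t\<close> on its row
\<open>b\<close> only. As \<open>0 < i < s/2\<close> and \<open>0 < b < t/2\<close> in the rectangle, divisibility of sums and
differences of values becomes a question about small numbers.
\<close>

lemma val_eq_dvd_s:
  "s dvd val i b + val i' b' \<longleftrightarrow> s dvd i + i'" "s dvd val i b - val i' b' \<longleftrightarrow> s dvd i - i'"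
  "s dvd val i b \<longleftrightarrow> s dvd i"
proof -
  have "val i b + val i' b' = (i + i') * t + s * (- b - b')"
    "val i b - val i' b' = (i - i') * t + s * (b' - b)"
    "val i b = i * t + s * (- b)"
    by (auto simp: val_def algebra_simps)
  then show "s dvd val i b + val i' b' \<longleftrightarrow> s dvd i + i'" "s dvd val i b - val i' b' \<longleftrightarrow> s dvd i - i'"
    "s dvd val i b \<longleftrightarrow> s dvd i"
    by (simp_all only: dvd_add_left_iff[OF dvd_triv_left] s_dvd_mult_t)
qed

lemma val_eq_dvd_t:
  "t dvd val i b + val i' b' \<longleftrightarrow> t dvd b + b'" "t dvd val i b - val i' b' \<longleftrightarrow> t dvd b - b'"
  "t dvd val i b \<longleftrightarrow> t dvd b"
proof -
  have "val i b + val i' b' = t * (i + i') + s * (- (b + b'))"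
    "val i b - val i' b' = t * (i - i') + s * (- (b - b'))"
    "val i b = t * i + s * (- b)"
    by (auto simp: val_def algebra_simps)
  then show "t dvd val i b + val i' b' \<longleftrightarrow> t dvd b + b'" "t dvd val i b - val i' b' \<longleftrightarrow> t dvd b - b'"
    "t dvd val i b \<longleftrightarrow> t dvd b"
    by (simp_all only: dvd_add_right_iff[OF dvd_triv_left] t_dvd_s_mult dvd_minus_iff)
qed

text \<open>
A value is different from \<open>0\<close> and \<open>h\<close> modulo \<open>s\<close>, and from \<open>0\<close> modulo \<open>t\<close>. For the residue
\<open>h\<close> the claims are doubled, which turns \<open>h\<close> into \<open>s\<close>.
\<close>

lemma not_dvd_val:
  assumes "(i, b) \<in> R"
  shows "\<not> s dvd val i b" "\<not> t dvd val i b" "\<not> s dvd 2 * val i b" "\<not> s dvd h + val i b"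
    "\<not> s dvd h - val i b"
proof -
  show "\<not> s dvd val i b" "\<not> t dvd val i b"
    unfolding val_eq_dvd_s val_eq_dvd_t
    using assms by (intro not_dvd_between; auto simp: s_eq t_eq)+
  show 2: "\<not> s dvd 2 * val i b"
    using val_eq_dvd_s(1)[of i b i b] not_dvd_between[of "i + i" s] assms
    by (auto simp: s_eq)
  show "\<not> s dvd h + val i b" "\<not> s dvd h - val i b"
  proof -
    have "s dvd 2 * (h + val i b) \<longleftrightarrow> s dvd 2 * val i b"
      "s dvd 2 * (h - val i b) \<longleftrightarrow> s dvd 2 * val i b"
      unfolding distrib_left right_diff_distrib s_eq_2h[symmetric]
      by (auto simp: dvd_add_right_iff dvd_diff_right_iff)
    then show "\<not> s dvd h + val i b" "\<not> s dvd h - val i b"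
      using 2 dvd_mult by blast+
  qed
qed

lemma val_neq:
  assumes "(i, b) \<in> R"
  shows "val i b \<noteq> 0" "val i b \<noteq> h" "val i b \<noteq> - h"
  using not_dvd_val[OF assms] by auto

text \<open>
The absolute values of distinct boxes are distinct, so that a part of the form \<open>v\<close> or \<open>-v\<close>
determines its box.
\<close>

lemma abs_val_inj:
  assumes "(i, b) \<in> R" "(i', b') \<in> R"
  shows "val i b + val i' b' \<noteq> 0" "val i b = val i' b' \<Longrightarrow> i = i' \<and> b = b'"
proof -
  have "\<not> s dvd i + i'"
    using assms by (intro not_dvd_between) (auto simp: s_eq)
  then show "val i b + val i' b' \<noteq> 0"
    using val_eq_dvd_s(1)[of i b i' b'] by auto
  show "i = i' \<and> b = b'" if "val i b = val i' b'"
  proof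
    show "i = i'"
      using assms val_eq_dvd_s(2)[of i b i' b'] that
      by (intro eq_if_dvd_diff[of s]) (auto simp: s_eq)
    then show "b = b'"
      using that s_pos by (simp add: val_def)
  qed
qed

text \<open>
Directly beyond the rectangle the sign of the value is constant: negative in the row
\<open>b = m + 1\<close>, and positive in the column \<open>i = h = n + 1\<close>. This keeps the chains obtained by
subtracting \<open>s\<close> or \<open>t\<close> from a part inside the rectangle.
\<close>

lemma val_beyond_last_row_neg:
  assumes "i \<le> int n"
  shows "val i (int m + 1) < 0"
proof -
  have "i * t \<le> int n * t"
    using assms t_pos by (intro mult_right_mono) auto
  also have "\<dots> < s * (int m + 1)"
    by (simp add: s_eq t_eq algebra_simps)
  finally show ?thesis by (simp add: val_def)
qed

lemma val_beyond_last_column_pos: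
  assumes "b \<le> int m"
  shows "0 < val h b"
proof -
  have "s * b \<le> s * int m"
    using assms s_pos by (intro mult_left_mono) auto
  also have "\<dots> < h * t"
    by (simp add: s_eq t_eq h_def algebra_simps)
  finally show ?thesis by (simp add: val_def)
qed

lemma val_last_row: "val i (int m) = h - (h - i) * t"
  unfolding val_def by (simp add: s_eq t_eq h_def algebra_simps)

lemma val_mono: "i \<le> i' \<Longrightarrow> b' \<le> b \<Longrightarrow> val i b \<le> val i' b'"
  unfolding val_def using s_pos t_pos by (intro diff_mono mult_right_mono mult_left_mono) auto

text \<open>
Coprimality makes every residue modulo \<open>s\<close> a multiple \<open>w t\<close> with \<open>0 \<le> w < s\<close>. The multiplier
\<open>w = 0\<close> gives the residue \<open>0\<close>, the multiplier \<open>w = h\<close> gives \<open>h\<close> because \<open>t\<close> is odd, and the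
others come in pairs \<open>w\<close> and \<open>s - w\<close> of opposite residues.
\<close>

lemma representation:
  assumes "\<not> s dvd x" "\<not> s dvd x - h"
  obtains i b where "i \<in> {1..int n}" "x = val i b \<or> x = - val i b"
proof -
  obtain u v where "u * t + v * s = 1"
    using bezout_int[of t s] coprime by (auto simp: gcd.commute)
  then have "x = x * (u * t + v * s)" by simp
  then have x: "x = (x * u) * t + (x * v) * s"
    by (simp add: algebra_simps)
  define w where "w = (x * u) mod s"
  define c where "c = - (x * v) - t * ((x * u) div s)"
  have "x * u = s * ((x * u) div s) + w"
    unfolding w_def by simp
  then have "x = (s * ((x * u) div s) + w) * t + (x * v) * s"
    using x by simp
  also have "\<dots> = val w c"
    unfolding val_def c_def by (simp add: algebra_simps)
  finally have xw: "x = val w c" .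
  have w: "0 \<le> w" "w < s"
    using s_pos unfolding w_def by auto
  have "w \<noteq> 0"
    using assms(1) xw by (auto simp: val_def)
  have "w \<noteq> h"
  proof
    assume "w = h"
    then have "x - h = s * (int m - c)"
      unfolding xw val_def \<open>w = h\<close> by (simp add: s_eq t_eq h_def algebra_simps)
    then show False using assms(2) by simp
  qed
  show thesis
  proof (cases "w < h")
    case True
    then show thesis
      using that[of w c] xw w \<open>w \<noteq> 0\<close> unfolding h_def by auto
  next
    case False
    (* val (i + s) (b + t) = val i b and val (- i) (- b) = - val i b. *)
    have "x = - val (s - w) (t - c)"
      unfolding xw by (simp add: val_def algebra_simps)
    moreover have "s - w \<in> {1..int n}"
      using False w \<open>w \<noteq> h\<close> unfolding h_def s_eq by auto
    ultimately show thesis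
      using that[of "s - w" "t - c"] by blast
  qed
qed

text \<open>
The boxes whose value belongs to the extension of \<open>P\<close> to the negative numbers in which
\<open>-x\<close> is a member exactly if \<open>x\<close> is not.
\<close>

definition to_ideal :: "int set \<Rightarrow> (int \<times> int) set" where
  "to_ideal P = {(i, b) \<in> R. (0 < val i b \<and> val i b \<in> P) \<or> (val i b < 0 \<and> - val i b \<notin> P)}"

definition of_ideal :: "(int \<times> int) set \<Rightarrow> int set" where
  "of_ideal D = {x. 0 < x \<and> (\<exists>i b. (i, b) \<in> R \<and>
     ((x = val i b \<and> (i, b) \<in> D) \<or> (x = - val i b \<and> (i, b) \<notin> D)))}"

lemma val_in_of_ideal:
  assumes "(i, b) \<in> R" "(i, b) \<in> D" "0 < val i b"
  shows "val i b \<in> of_ideal D"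
  using assms unfolding of_ideal_def by blast

lemma minus_val_in_of_ideal:
  assumes "(i, b) \<in> R" "(i, b) \<notin> D" "val i b < 0"
  shows "- val i b \<in> of_ideal D"
proof -
  have "0 < - val i b" using assms(3) by simp
  then show ?thesis using assms(1,2) unfolding of_ideal_def by blast
qed

context
  fixes P assumes P: "core_set s P" "core_set t P"
begin

text \<open>
If \<open>h + t\<close> is a part then so is \<open>h\<close>. According to the sign of \<open>h - t\<close>, either \<open>h - t\<close> is a
part and \<open>(h + t) + (h - t) = s\<close>, or \<open>(h + t) - s = t - h\<close> is a part and \<open>h + (t - h) = t\<close>.
\<close>

lemma half_plus_t_notin: "h + t \<notin> P"
proof
  assume ht: "h + t \<in> P"
  then have h: "h \<in> P"
    using core_set_diff_multiple[OF P(2) t_pos ht, of 1] h_pos by simp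
  have "h \<noteq> t"
    using core_setD(2)[OF P(2) h] by auto
  show False
  proof (cases "t < h")
    case True
    then have "h - t \<in> P"
      using core_set_diff_multiple[OF P(2) t_pos h, of 1] by simp
    then show False
      using core_setD(3)[OF P(1) ht, of "h - t"] t_pos by (simp add: s_eq_2h)
  next
    case False
    then have "h + t - s * 1 \<in> P"
      using \<open>h \<noteq> t\<close> by (intro core_set_diff_multiple[OF P(1) s_pos ht]) (auto simp: s_eq_2h)
    then have "t - h \<in> P"
      by (simp add: s_eq_2h)
    moreover have "h \<noteq> t - h"
      by (simp add: s_eq t_eq h_def) presburger
    ultimately show False
      using core_setD(3)[OF P(2) h, of "t - h"] by simp
  qed
qed

text \<open>
The representation of a part by a pair \<open>(i, b)\<close> with \<open>1 \<le> i \<le> n\<close> has \<open>b\<close> in range: for \<open>b \<le> 0\<close>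
the part \<open>i t - s b\<close> reduces to the multiple \<open>i t\<close> of \<open>t\<close>, and for \<open>b > m\<close> the part
\<open>s b - i t\<close> reduces first to \<open>s (m + 1) - i t = h + t + (n - i) t\<close> and then to \<open>h + t\<close>.
\<close>

lemma part_eq_val:
  assumes "x \<in> P" "x \<noteq> h"
  obtains i b where "(i, b) \<in> R" "x = val i b \<or> x = - val i b"
proof -
  have "\<not> s dvd x - h"
  proof
    assume "s dvd x - h"
    then obtain k where k: "x - h = s * k" by blast
    have "0 < x" using core_setD(1)[OF P(1) assms(1)] .
    have "k \<noteq> 0" using k assms(2) by auto
    moreover have "0 \<le> k"
    proof (rule ccontr)
      assume "\<not> 0 \<le> k"
      then have "s * k \<le> s * (-1)" using s_pos by (intro mult_left_mono) auto
      then have "x - h \<le> - s" using k by simp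
      then show False using \<open>0 < x\<close> s_eq_2h h_pos by linarith
    qed
    ultimately have "x - s * k \<in> P"
      using k h_pos by (intro core_set_diff_multiple[OF P(1) s_pos assms(1)]) auto
    then have "h \<in> P" using k by (simp add: algebra_simps)
    moreover have "x + h = s * (k + 1)"
      using k s_eq_2h by (simp add: algebra_simps)
    ultimately show False
      using core_setD(3)[OF P(1) assms(1), of h] assms(2) by simp
  qed
  then obtain i b where i: "i \<in> {1..int n}" and x: "x = val i b \<or> x = - val i b"
    using representation core_setD(2)[OF P(1) assms(1)] by metis
  have "0 < x" using core_setD(1)[OF P(1) assms(1)] .
  have it: "0 < i * t" using i t_pos by auto
  have "1 \<le> b"
  proof (rule ccontr)
    assume "\<not> 1 \<le> b"
    then have "s * b \<le> 0"
      using s_pos by (simp add: mult_le_0_iff)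
    then have "x = val i b"
      using x \<open>0 < x\<close> it by (auto simp: val_def)
    then have "i * t = x - s * (- b)" by (simp add: val_def)
    moreover have "x - s * (- b) \<in> P"
      using \<open>\<not> 1 \<le> b\<close> it \<open>i * t = x - s * (- b)\<close>
      by (intro core_set_diff_multiple[OF P(1) s_pos assms(1)]) auto
    ultimately have "i * t \<in> P" by simp
    then show False
      using core_setD(2)[OF P(2)] dvd_triv_right by blast
  qed
  moreover have "b \<le> int m"
  proof (rule ccontr)
    assume b: "\<not> b \<le> int m"
    have neg: "val i (int m + 1) < 0"
      using i by (intro val_beyond_last_row_neg) auto
    then have "val i b < 0"
      using val_mono[of i i "int m + 1" b] b by simp
    then have "x = - val i b" using x \<open>0 < x\<close> by auto
    then have eq: "x - s * (b - (int m + 1)) = - val i (int m + 1)"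
      by (simp add: val_def algebra_simps)
    then have "- val i (int m + 1) \<in> P"
      using core_set_diff_multiple[OF P(1) s_pos assms(1), of "b - (int m + 1)"] neg b by simp
    moreover have "- val i (int m + 1) - t * (int n - i) = h + t"
      unfolding val_def by (simp add: s_eq t_eq h_def algebra_simps)
    ultimately have "h + t \<in> P"
      using core_set_diff_multiple[OF P(2) t_pos, of "- val i (int m + 1)" "int n - i"]
        i h_pos t_pos by simp
    then show False using half_plus_t_notin by simp
  qed
  ultimately show thesis
    using that[of i b] i x by simp
qed

lemma finite_simultaneous_core: "finite P"
proof (rule finite_subset)
  show "P \<subseteq> insert h ((\<lambda>(i, b). val i b) ` R \<union> (\<lambda>(i, b). - val i b) ` R)"
  proof
    fix x assume "x \<in> P"
    then show "x \<in> insert h ((\<lambda>(i, b). val i b) ` R \<union> (\<lambda>(i, b). - val i b) ` R)"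
      by (cases "x = h") (auto elim!: part_eq_val[of x])
  qed
qed auto

text \<open>
Moving in the rectangle subtracts multiples of \<open>s\<close> and \<open>t\<close> from the value. If both values are
positive or both negative, the closure of \<open>P\<close> applies to them or to their negatives; if the sign
changes from \<open>v > 0\<close> to \<open>v' < 0\<close>, then \<open>v\<close> and \<open>-v'\<close> cannot both be parts, because their sum is
a multiple of \<open>s\<close> or \<open>t\<close>.
\<close>

lemma to_ideal_in_ideals: "to_ideal P \<in> ideals n m"
proof (rule idealsI)
  show "to_ideal P \<subseteq> R"
    unfolding to_ideal_def by auto
next
  fix i b i' b'
  assume ib: "(i, b) \<in> to_ideal P" and le: "1 \<le> i'" "i' \<le> i" "b \<le> b'" "b' \<le> int m"
  have R: "(i, b) \<in> R" using ib unfolding to_ideal_def by auto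
  have down: "y \<in> P" if "core_set d P" "0 < d" "0 \<le> k" "x \<in> P" "0 < y" "y = x - d * k" for d k x y
    using core_set_diff_multiple[OF that(1,2,4,3)] that by simp
  have step: "0 < v' \<and> v' \<in> P \<or> v' < 0 \<and> - v' \<notin> P"
    if d: "core_set d P" "0 < d" "0 \<le> k" and v': "v' = v - d * k" "v' \<noteq> 0" "v + v' \<noteq> 0"
      and v: "0 < v \<and> v \<in> P \<or> v < 0 \<and> - v \<notin> P" for d k v v'
  proof (cases "0 < v'")
    case True
    have "0 \<le> d * k" using d by simp
    then have "0 < v" using True v' by linarith
    then show ?thesis
      using v down[OF d _ True v'(1)] True by simp
  next
    case False
    have "- v' \<notin> P"
    proof
      assume in_P: "- v' \<in> P"
      show False
      proof (cases "0 < v")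
        case True
        have "d dvd v + - v'" using v' by simp
        moreover have "v \<in> P" using v True by linarith
        moreover have "v \<noteq> - v'" using v'(3) by linarith
        ultimately show False
          using core_setD(3)[OF d(1)] in_P by blast
      next
        case False
        moreover have "0 \<le> d * k" using d by simp
        ultimately have "0 < - v" using v by linarith
        then have "- v \<in> P"
          using v'(1) by (intro down[OF d in_P]) auto
        then show False using v False by simp
      qed
    qed
    then show ?thesis using False v'(2) by auto
  qed
  have R1: "(i, b') \<in> R" and R2: "(i', b') \<in> R" using R le by auto
  have v1: "val i b' = val i b - s * (b' - b)" and v2: "val i' b' = val i b' - t * (i - i')"
    by (simp_all add: val_diff)
  have "0 < val i b \<and> val i b \<in> P \<or> val i b < 0 \<and> - val i b \<notin> P"
    using ib unfolding to_ideal_def by blast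
  from step[OF P(1) s_pos _ v1 val_neq(1)[OF R1] abs_val_inj(1)[OF R R1] this]
  have "0 < val i b' \<and> val i b' \<in> P \<or> val i b' < 0 \<and> - val i b' \<notin> P"
    using le by simp
  from step[OF P(2) t_pos _ v2 val_neq(1)[OF R2] abs_val_inj(1)[OF R1 R2] this]
  have "0 < val i' b' \<and> val i' b' \<in> P \<or> val i' b' < 0 \<and> - val i' b' \<notin> P"
    using le by simp
  then show "(i', b') \<in> to_ideal P"
    using R2 unfolding to_ideal_def by auto
qed

text \<open>
The values of the last row are \<open>h - k t\<close> with \<open>k = h - i\<close>. The positive ones are parts by closure,
and the negative of a negative one has the sum \<open>k t\<close> with \<open>h\<close>.
\<close>

lemma last_row_subset_to_ideal:
  assumes h: "h \<in> P"
  shows "{1..int n} \<times> {int m} \<subseteq> to_ideal P"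
proof clarify
  fix i assume i: "i \<in> {1..int n}"
  then have R: "(i, int m) \<in> R" using m_pos by auto
  have row: "val i (int m) = h - t * (h - i)"
    unfolding val_last_row by simp
  show "(i, int m) \<in> to_ideal P"
  proof (cases "0 < val i (int m)")
    case True
    then have "h - t * (h - i) \<in> P"
      using row i unfolding h_def
      by (intro core_set_diff_multiple[OF P(2) t_pos h[unfolded h_def]]) auto
    then show ?thesis
      using True R row unfolding to_ideal_def by auto
  next
    case False
    have "- val i (int m) \<notin> P"
    proof
      assume "- val i (int m) \<in> P"
      moreover have "h + - val i (int m) = t * (h - i)"
        unfolding row by simp
      ultimately show False
        using core_setD(3)[OF P(2) h, of "- val i (int m)"] val_neq(3)[OF R] by auto
    qed
    then show ?thesis
      using False R val_neq(1)[OF R] unfolding to_ideal_def by auto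
  qed
qed

lemma of_ideal_to_ideal: "of_ideal (to_ideal P) = P - {h}"
proof (intro equalityI subsetI)
  fix x assume "x \<in> of_ideal (to_ideal P)"
  then obtain i b where ib: "(i, b) \<in> R" "0 < x"
    "(x = val i b \<and> (i, b) \<in> to_ideal P) \<or> (x = - val i b \<and> (i, b) \<notin> to_ideal P)"
    unfolding of_ideal_def by blast
  then show "x \<in> P - {h}"
    using val_neq[OF ib(1)] unfolding to_ideal_def by auto
next
  fix x assume x: "x \<in> P - {h}"
  then obtain i b where ib: "(i, b) \<in> R" "x = val i b \<or> x = - val i b"
    using part_eq_val by blast
  moreover have "0 < x" using x core_setD(1)[OF P(1)] by blast
  ultimately show "x \<in> of_ideal (to_ideal P)"
    using x unfolding of_ideal_def to_ideal_def by force
qed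

end

context
  fixes D assumes D: "D \<in> ideals n m"
begin

lemma to_ideal_of_ideal:
  assumes "E \<subseteq> {h}"
  shows "to_ideal (of_ideal D \<union> E) = D"
proof -
  have "(i, b) \<in> to_ideal (of_ideal D \<union> E) \<longleftrightarrow> (i, b) \<in> D" if R: "(i, b) \<in> R" for i b
  proof -
    have "val i b \<notin> E" "- val i b \<notin> E"
      using val_neq[OF R] assms by auto
    moreover have "val i b \<in> of_ideal D \<longleftrightarrow> (i, b) \<in> D" if "0 < val i b"
    proof
      assume "val i b \<in> of_ideal D"
      then obtain i' b' where *: "(i', b') \<in> R"
        "val i b = val i' b' \<and> (i', b') \<in> D \<or> val i b = - val i' b' \<and> (i', b') \<notin> D"
        unfolding of_ideal_def by blast
      then show "(i, b) \<in> D"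
        using abs_val_inj[OF R *(1)] by auto
    qed (use that R in \<open>auto simp: of_ideal_def\<close>)
    moreover have "- val i b \<in> of_ideal D \<longleftrightarrow> (i, b) \<notin> D" if "val i b < 0"
    proof
      assume "- val i b \<in> of_ideal D"
      then obtain i' b' where *: "(i', b') \<in> R"
        "- val i b = val i' b' \<and> (i', b') \<in> D \<or> - val i b = - val i' b' \<and> (i', b') \<notin> D"
        unfolding of_ideal_def by blast
      then show "(i, b) \<notin> D"
        using abs_val_inj[OF R *(1)] by auto
    qed (use that R in \<open>auto simp: of_ideal_def\<close>)
    ultimately show ?thesis
      using R val_neq(1)[OF R] unfolding to_ideal_def by (cases "0 < val i b") auto
  qed
  moreover have "to_ideal (of_ideal D \<union> E) \<subseteq> R"
    unfolding to_ideal_def by auto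
  ultimately show ?thesis
    using ideals_subset[OF D] by auto
qed

lemma half_notin_of_ideal: "h \<notin> of_ideal D"
proof
  assume "h \<in> of_ideal D"
  then obtain i b where "(i, b) \<in> R" "h = val i b \<or> h = - val i b"
    unfolding of_ideal_def by blast
  then show False using val_neq[of i b] by auto
qed

lemma of_ideal_cases:
  assumes "x \<in> of_ideal D \<union> E" "E \<subseteq> {h}"
  obtains (pos) i b where "(i, b) \<in> R" "(i, b) \<in> D" "x = val i b" "0 < val i b"
    | (neg) i b where "(i, b) \<in> R" "(i, b) \<notin> D" "x = - val i b" "val i b < 0"
    | (half) "x = h" "h \<in> E"
  using assms unfolding of_ideal_def by force

text \<open>
A chain of parts with difference \<open>s\<close> runs along a column of the rectangle until the value
changes sign. Two parts whose sum is divisible by \<open>s\<close> would be \<open>v\<close> and \<open>-v'\<close> for two boxes of the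
same column with \<open>v > 0 > v'\<close>, where \<open>v\<close> is in \<open>D\<close> and \<open>v'\<close> is not; but \<open>D\<close> is closed downward.
\<close>

lemma core_set_s_of_ideal:
  assumes E: "E \<subseteq> {h}"
  shows "core_set s (of_ideal D \<union> E)"
proof -
  let ?P = "of_ideal D \<union> E"
  have s_h: "\<not> s dvd h"
    using h_pos by (intro not_dvd_between) (auto simp: s_eq_2h)
  have "0 < x \<and> \<not> s dvd x \<and> (s < x \<longrightarrow> x - s \<in> ?P)" if "x \<in> ?P" for x
    using that E
  proof (cases rule: of_ideal_cases)
    case (pos i b)
    have "x - s \<in> ?P" if "s < x"
    proof -
      have v: "0 < val i (b + 1)" "x - s = val i (b + 1)"
        using that pos val_diff(1)[of i b 1] by auto
      have "\<not> int m \<le> b"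
      proof
        assume "int m \<le> b"
        then have "val i (b + 1) \<le> val i (int m + 1)" by (intro val_mono) auto
        then show False using v val_beyond_last_row_neg[of i] pos(1) by auto
      qed
      then have "(i, b + 1) \<in> D" "(i, b + 1) \<in> R"
        using ideals_closed[OF D pos(2), of i "b + 1"] pos(1) by auto
      then show ?thesis
        using v val_in_of_ideal by auto
    qed
    then show ?thesis
      using pos not_dvd_val(1)[OF pos(1)] by simp
  next
    case (neg i b)
    have "x - s \<in> ?P" if "s < x"
    proof -
      have v: "val i (b - 1) < 0" "x - s = - val i (b - 1)"
        using that neg val_diff(1)[of i b "-1"] by auto
      have "b \<noteq> 1"
      proof
        assume "b = 1"
        then have "val i (b - 1) = i * t" by (simp add: val_def)
        moreover have "0 < i * t" using neg(1) t_pos by auto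
        ultimately show False using v by simp
      qed
      then have "(i, b - 1) \<in> R" using neg(1) by auto
      moreover have "(i, b - 1) \<notin> D"
        using ideals_closed[OF D, of i "b - 1" i b] neg(1,2) by auto
      ultimately show ?thesis
        using v minus_val_in_of_ideal by auto
    qed
    then show ?thesis
      using neg not_dvd_val(1)[OF neg(1)] by simp
  next
    case half
    then show ?thesis using h_pos s_h s_eq_2h by auto
  qed
  moreover have "\<not> s dvd x + y" if x: "x \<in> ?P" and y: "y \<in> ?P" and neq: "x \<noteq> y" for x y
  proof -
    have same: "\<not> s dvd val i b + val i' b'" if "(i, b) \<in> R" "(i', b') \<in> R" for i b i' b'
      unfolding val_eq_dvd_s using that by (intro not_dvd_between) (auto simp: s_eq)
    have opp: "\<not> s dvd val i b - val i' b'"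
      if ib: "(i, b) \<in> R" "(i, b) \<in> D" "0 < val i b" and ib': "(i', b') \<in> R" "(i', b') \<notin> D" "val i' b' < 0"
      for i b i' b'
    proof
      assume "s dvd val i b - val i' b'"
      then have "i = i'"
        unfolding val_eq_dvd_s using ib ib' by (intro eq_if_dvd_diff[of s]) (auto simp: s_eq)
      have "b < b'"
        using val_mono[of i i' b' b] \<open>i = i'\<close> ib(3) ib'(3) by linarith
      then show False
        using ideals_closed[OF D ib(2), of i' b'] ib'(1,2) \<open>i = i'\<close> by auto
    qed
    have half: "\<not> s dvd h + val i b" "\<not> s dvd h - val i b" if "(i, b) \<in> R" for i b
      using not_dvd_val[OF that] by auto
    have minus: "s dvd - u - v \<longleftrightarrow> s dvd u + v" "s dvd v + h \<longleftrightarrow> s dvd h + v" "s dvd - v + h \<longleftrightarrow> s dvd h - v"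
       "s dvd - u + v \<longleftrightarrow> s dvd v - u" for u v
      using dvd_minus_iff[of s "u + v"] by (simp_all add: algebra_simps)
    show ?thesis
      using x E
    proof (cases rule: of_ideal_cases)
      case x: (pos i b)
      show ?thesis
        using y E by (cases rule: of_ideal_cases) (use x same opp half minus in auto)
    next
      case x: (neg i b)
      show ?thesis
        using y E by (cases rule: of_ideal_cases) (use x same opp half minus in auto)
    next
      case x: half
      show ?thesis
        using y E by (cases rule: of_ideal_cases) (use x half neq in auto)
    qed
  qed
  ultimately show ?thesis
    unfolding core_set_def by blast
qed

text \<open>
The same argument along the rows. The additional part \<open>h\<close> requires that \<open>D\<close> contain the last row:
\<open>h - t\<close> is the value of the box \<open>(n, m)\<close>, and \<open>h - v\<close> is divisible by \<open>t\<close> exactly for the boxes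
of the last row.
\<close>

lemma core_set_t_of_ideal:
  assumes E: "E \<subseteq> {h}" and row: "h \<in> E \<Longrightarrow> {1..int n} \<times> {int m} \<subseteq> D"
  shows "core_set t (of_ideal D \<union> E)"
proof -
  let ?P = "of_ideal D \<union> E"
  have t_h: "\<not> t dvd h"
  proof
    assume "t dvd h"
    then have "t dvd s * 1" unfolding s_eq_2h by simp
    then have "t dvd 1" unfolding t_dvd_s_mult .
    then show False
      using not_dvd_between[of 1 t] m_pos by (simp add: t_eq)
  qed
  have "0 < x \<and> \<not> t dvd x \<and> (t < x \<longrightarrow> x - t \<in> ?P)" if "x \<in> ?P" for x
    using that E
  proof (cases rule: of_ideal_cases)
    case (pos i b)
    have "x - t \<in> ?P" if "t < x"
    proof -
      have v: "0 < val (i - 1) b" "x - t = val (i - 1) b"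
        using that pos val_diff(2)[of i b 1] by auto
      have "i \<noteq> 1"
      proof
        assume "i = 1"
        then have "val (i - 1) b = - (s * b)" by (simp add: val_def)
        moreover have "0 < s * b" using pos(1) s_pos by auto
        ultimately show False using v by simp
      qed
      then have "(i - 1, b) \<in> D" "(i - 1, b) \<in> R"
        using ideals_closed[OF D pos(2), of "i - 1" b] pos(1) by auto
      then show ?thesis
        using v val_in_of_ideal by auto
    qed
    then show ?thesis
      using pos not_dvd_val(2)[OF pos(1)] by simp
  next
    case (neg i b)
    have "x - t \<in> ?P" if "t < x"
    proof -
      have v: "val (i + 1) b < 0" "x - t = - val (i + 1) b"
        using that neg val_diff(2)[of i b "-1"] by auto
      have "i \<noteq> int n"
        using v(1) val_beyond_last_column_pos[of b] neg(1) unfolding h_def by auto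
      then have "(i + 1, b) \<in> R" using neg(1) by auto
      moreover have "(i + 1, b) \<notin> D"
        using ideals_closed[OF D, of "i + 1" b i b] neg(1,2) by auto
      ultimately show ?thesis
        using v minus_val_in_of_ideal by auto
    qed
    then show ?thesis
      using neg not_dvd_val(2)[OF neg(1)] by simp
  next
    case half
    have "h - t \<in> ?P" if "t < h"
    proof -
      have n: "(int n, int m) \<in> R" using that m_pos by (auto simp: h_def t_eq)
      moreover have "(int n, int m) \<in> D" using row[OF half(2)] n by auto
      moreover have "val (int n) (int m) = h - t"
        unfolding val_last_row by (simp add: h_def)
      ultimately show ?thesis
        using that val_in_of_ideal by (metis UnI1 diff_gt_0_iff_gt)
    qed
    then show ?thesis
      using half h_pos t_h by simp
  qed
  moreover have "\<not> t dvd x + y" if x: "x \<in> ?P" and y: "y \<in> ?P" and neq: "x \<noteq> y" for x y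
  proof -
    have same: "\<not> t dvd val i b + val i' b'" if "(i, b) \<in> R" "(i', b') \<in> R" for i b i' b'
      unfolding val_eq_dvd_t using that by (intro not_dvd_between) (auto simp: t_eq)
    have opp: "\<not> t dvd val i b - val i' b'"
      if ib: "(i, b) \<in> R" "(i, b) \<in> D" "0 < val i b" and ib': "(i', b') \<in> R" "(i', b') \<notin> D" "val i' b' < 0"
      for i b i' b'
    proof
      assume "t dvd val i b - val i' b'"
      then have "b = b'"
        unfolding val_eq_dvd_t using ib ib' by (intro eq_if_dvd_diff[of t]) (auto simp: t_eq)
      have "i' < i"
        using val_mono[of i i' b' b] \<open>b = b'\<close> ib(3) ib'(3) by linarith
      then show False
        using ideals_closed[OF D ib(2), of i' b'] ib'(1,2) \<open>b = b'\<close> by auto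
    qed
    have two: "t dvd u \<Longrightarrow> t dvd 2 * u" for u by simp
    have half_pos: "\<not> t dvd h + val i b" if R: "(i, b) \<in> R" for i b
    proof
      assume dvd: "t dvd h + val i b"
      have "t dvd s * (1 - 2 * b)"
      proof -
        have "2 * (h + val i b) = t * (2 * i) + s * (1 - 2 * b)"
          unfolding val_def by (simp add: s_eq_2h algebra_simps)
        then show ?thesis
          using two[OF dvd] by (simp only: dvd_add_right_iff[OF dvd_triv_left])
      qed
      then have "t dvd - (1 - 2 * b)"
        unfolding t_dvd_s_mult dvd_minus_iff .
      then show False
        using not_dvd_between[of "2 * b - 1" t] R by (auto simp: t_eq)
    qed
    have half_neg: "\<not> t dvd h - val i b" if R: "(i, b) \<in> R" "(i, b) \<notin> D" and h: "h \<in> E" for i b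
    proof
      assume dvd: "t dvd h - val i b"
      have "t dvd s * (2 * b + 1)"
      proof -
        have "2 * (h - val i b) = t * (- (2 * i)) + s * (2 * b + 1)"
          unfolding val_def by (simp add: s_eq_2h algebra_simps)
        then show ?thesis
          using two[OF dvd] by (simp only: dvd_add_right_iff[OF dvd_triv_left])
      qed
      then have "\<not> 2 * b + 1 < t"
        unfolding t_dvd_s_mult using not_dvd_between[of "2 * b + 1" t] R(1) by auto
      then have "b = int m"
        using R(1) by (auto simp: t_eq)
      then have "(i, b) \<in> {1..int n} \<times> {int m}" using R(1) by auto
      then show False using row[OF h] R(2) by blast
    qed
    have minus: "t dvd - u - v \<longleftrightarrow> t dvd u + v" "t dvd v + h \<longleftrightarrow> t dvd h + v" "t dvd - v + h \<longleftrightarrow> t dvd h - v"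
       "t dvd - u + v \<longleftrightarrow> t dvd v - u" for u v
      using dvd_minus_iff[of t "u + v"] by (simp_all add: algebra_simps)
    show ?thesis
      using x E
    proof (cases rule: of_ideal_cases)
      case x: (pos i b)
      show ?thesis
        using y E by (cases rule: of_ideal_cases) (use x same opp half_pos half_neg minus in auto)
    next
      case x: (neg i b)
      show ?thesis
        using y E by (cases rule: of_ideal_cases) (use x same opp half_pos half_neg minus in auto)
    next
      case x: half
      show ?thesis
        using y E by (cases rule: of_ideal_cases) (use x half_pos half_neg neq in auto)
    qed
  qed
  ultimately show ?thesis
    unfolding core_set_def by blast
qed

end

lemma card_cores_without_half:
  "card {P. core_set s P \<and> core_set t P \<and> h \<notin> P} = (n + m) choose n"
proof -
  have "bij_betw to_ideal {P. core_set s P \<and> core_set t P \<and> h \<notin> P} (ideals n m)"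
  proof (rule bij_betw_byWitness[where f' = of_ideal])
    show "of_ideal ` ideals n m \<subseteq> {P. core_set s P \<and> core_set t P \<and> h \<notin> P}"
    proof clarify
      fix D assume D: "D \<in> ideals n m"
      show "core_set s (of_ideal D) \<and> core_set t (of_ideal D) \<and> h \<notin> of_ideal D"
        using core_set_s_of_ideal[OF D, of "{}"] core_set_t_of_ideal[OF D, of "{}"]
          half_notin_of_ideal[OF D] by simp
    qed
    show "\<forall>P\<in>{P. core_set s P \<and> core_set t P \<and> h \<notin> P}. of_ideal (to_ideal P) = P"
      using of_ideal_to_ideal by simp
    show "\<forall>D\<in>ideals n m. to_ideal (of_ideal D) = D"
      using to_ideal_of_ideal[of _ "{}"] by simp
    show "to_ideal ` {P. core_set s P \<and> core_set t P \<and> h \<notin> P} \<subseteq> ideals n m"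
      using to_ideal_in_ideals by blast
  qed
  from bij_betw_same_card[OF this] show ?thesis
    unfolding card_ideals .
qed

lemma card_cores_with_half:
  "card {P. core_set s P \<and> core_set t P \<and> h \<in> P} = (n + (m - 1)) choose n"
proof -
  let ?row = "{1..int n} \<times> {int m}"
  have "bij_betw to_ideal {P. core_set s P \<and> core_set t P \<and> h \<in> P} {D \<in> ideals n m. ?row \<subseteq> D}"
  proof (rule bij_betw_byWitness[where f' = "\<lambda>D. of_ideal D \<union> {h}"])
    show "(\<lambda>D. of_ideal D \<union> {h}) ` {D \<in> ideals n m. ?row \<subseteq> D}
        \<subseteq> {P. core_set s P \<and> core_set t P \<and> h \<in> P}"
    proof clarify
      fix D assume D: "D \<in> ideals n m" "?row \<subseteq> D"
      show "core_set s (of_ideal D \<union> {h}) \<and> core_set t (of_ideal D \<union> {h}) \<and> h \<in> of_ideal D \<union> {h}"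
        using core_set_s_of_ideal[OF D(1), of "{h}"] core_set_t_of_ideal[OF D(1), of "{h}"] D(2)
        by simp
    qed
    show "\<forall>P\<in>{P. core_set s P \<and> core_set t P \<and> h \<in> P}. of_ideal (to_ideal P) \<union> {h} = P"
    proof clarify
      fix P assume P: "core_set s P" "core_set t P" "h \<in> P"
      show "of_ideal (to_ideal P) \<union> {h} = P"
        unfolding of_ideal_to_ideal[OF P(1,2)] using P(3) by blast
    qed
    show "\<forall>D\<in>{D \<in> ideals n m. ?row \<subseteq> D}. to_ideal (of_ideal D \<union> {h}) = D"
      by (simp add: to_ideal_of_ideal del: Un_insert_right)
    show "to_ideal ` {P. core_set s P \<and> core_set t P \<and> h \<in> P} \<subseteq> {D \<in> ideals n m. ?row \<subseteq> D}"
    proof clarify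
      fix P assume P: "core_set s P" "core_set t P" "h \<in> P"
      show "to_ideal P \<in> ideals n m \<and> ?row \<subseteq> to_ideal P"
        using to_ideal_in_ideals[OF P(1,2)] last_row_subset_to_ideal[OF P] by (rule conjI)
    qed
  qed
  then have "card {P. core_set s P \<and> core_set t P \<and> h \<in> P} = card {D \<in> ideals n m. ?row \<subseteq> D}"
    by (rule bij_betw_same_card)
  also have "\<dots> = card (ideals n (m - 1))"
    using card_ideals_with_full_row[of n "m - 1"] m_pos by simp
  finally show ?thesis by (simp add: card_ideals)
qed

lemma card_simultaneous_cores:
  "card {P. core_set s P \<and> core_set t P} = ((n + m) choose n) + ((n + (m - 1)) choose n)"
proof -
  let ?X = "{P. core_set s P \<and> core_set t P \<and> h \<notin> P}"
    and ?Y = "{P. core_set s P \<and> core_set t P \<and> h \<in> P}"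
  have "card ?X > 0" "card ?Y > 0"
    unfolding card_cores_without_half card_cores_with_half by simp_all
  then have "finite ?X" "finite ?Y"
    using card_gt_0_iff by blast+
  then have "card (?X \<union> ?Y) = card ?X + card ?Y"
    by (intro card_Un_disjoint) auto
  moreover have "{P. core_set s P \<and> core_set t P} = ?X \<union> ?Y" by blast
  ultimately show ?thesis
    unfolding card_cores_without_half card_cores_with_half by metis
qed

end


section \<open>Lattice paths\<close>

lemma Nil_mem_NE: "[] \<in> NE a b \<longleftrightarrow> a = 0 \<and> b = 0"
  by (auto simp: NE_def zero_prod_def)

lemma Cons_mem_NE:
  "c # p \<in> NE a b \<longleftrightarrow> c = (1, 0) \<and> p \<in> NE (a - 1) b \<or> c = (0, 1) \<and> p \<in> NE a (b - 1)"
proof -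
  obtain u v where uv: "sum_list p = (u, v)" by (cases "sum_list p")
  have "(1, 0) + (u, v) = (a, b) \<longleftrightarrow> (u, v) = (a - 1, b)"
    "(0, 1) + (u, v) = (a, b) \<longleftrightarrow> (u, v) = (a, b - 1)"
    by auto
  then show ?thesis
    unfolding NE_def mem_Collect_eq list.set sum_list.Cons uv by blast
qed

lemma NE_negative: "a < 0 \<or> b < 0 \<Longrightarrow> NE a b = {}"
proof -
  have "p \<in> NE a b \<Longrightarrow> 0 \<le> a \<and> 0 \<le> b" for p
  proof (induction p arbitrary: a b)
    case Nil
    then show ?case by (simp add: Nil_mem_NE)
  next
    case (Cons c p)
    then show ?case
      unfolding Cons_mem_NE by (meson diff_ge_0_iff_ge order_trans zero_le_one)
  qed
  then show "a < 0 \<or> b < 0 \<Longrightarrow> NE a b = {}"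
    by (meson equals0I not_le)
qed

lemma NE_origin: "NE 0 0 = {[]}"
proof (rule set_eqI)
  fix p
  show "p \<in> NE 0 0 \<longleftrightarrow> p \<in> {[]}"
    by (cases p) (simp_all add: Nil_mem_NE Cons_mem_NE NE_negative)
qed

lemma NE_first_step:
  assumes "a \<noteq> 0 \<or> b \<noteq> 0"
  shows "NE a b = (#) (1, 0) ` NE (a - 1) b \<union> (#) (0, 1) ` NE a (b - 1)" (is "_ = ?R")
proof (rule set_eqI)
  fix p
  show "p \<in> NE a b \<longleftrightarrow> p \<in> ?R"
    using assms by (cases p) (auto simp: Nil_mem_NE Cons_mem_NE)
qed

lemma Cons_images_disjoint: "c \<noteq> d \<Longrightarrow> (#) c ` X \<inter> (#) d ` Y = {}"
  by blast

lemma finite_card_NE: "finite (NE (int a) (int b)) \<and> card (NE (int a) (int b)) = (a + b) choose b"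
proof (induction "a + b" arbitrary: a b)
  case 0
  then have "a = 0" "b = 0" by auto
  then show ?case by (simp add: NE_origin)
next
  case (Suc k)
  have E: "finite (NE (int a - 1) (int b)) \<and>
      card (NE (int a - 1) (int b)) = (if a = 0 then 0 else (a - 1 + b) choose b)"
  proof (cases a)
    case a: (Suc a')
    then show ?thesis using Suc(1)[of a' b] Suc(2) by simp
  qed (simp add: NE_negative)
  have N: "finite (NE (int a) (int b - 1)) \<and>
      card (NE (int a) (int b - 1)) = (if b = 0 then 0 else (a + (b - 1)) choose (b - 1))"
  proof (cases b)
    case b: (Suc b')
    then show ?thesis using Suc(1)[of a b'] Suc(2) by simp
  qed (simp add: NE_negative)
  have "int a \<noteq> 0 \<or> int b \<noteq> 0" using Suc(2) by auto
  then have eq: "NE (int a) (int b) =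
      (#) (1, 0) ` NE (int a - 1) (int b) \<union> (#) (0, 1) ` NE (int a) (int b - 1)"
    by (rule NE_first_step)
  have "card (NE (int a) (int b)) = card (NE (int a - 1) (int b)) + card (NE (int a) (int b - 1))"
  proof -
    have disj: "(#) (1, 0) ` NE (int a - 1) (int b) \<inter> (#) (0, 1) ` NE (int a) (int b - 1) = {}"
      by (rule Cons_images_disjoint) simp
    have fin: "finite (NE (int a - 1) (int b))" "finite (NE (int a) (int b - 1))"
      by (rule conjunct1[OF E], rule conjunct1[OF N])
    have "card (NE (int a) (int b)) =
        card ((#) (1, 0) ` NE (int a - 1) (int b)) + card ((#) (0, 1) ` NE (int a) (int b - 1))"
      unfolding eq by (rule card_Un_disjoint[OF finite_imageI[OF fin(1)] finite_imageI[OF fin(2)] disj])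
    then show ?thesis by (simp add: card_image)
  qed
  also have "\<dots> = (if a = 0 then 0 else (a - 1 + b) choose b) +
      (if b = 0 then 0 else (a + (b - 1)) choose (b - 1))"
    unfolding conjunct2[OF E] conjunct2[OF N] ..
  also have "\<dots> = (a + b) choose b"
  proof (cases b)
    case b: (Suc b')
    then show ?thesis by (cases a) simp_all
  qed (use Suc(2) in simp)
  finally have "card (NE (int a) (int b)) = (a + b) choose b" .
  moreover have "finite (NE (int a) (int b))"
    unfolding eq by (intro finite_UnI finite_imageI conjunct1[OF E] conjunct1[OF N])
  ultimately show ?case by blast
qed

section \<open>The number of simultaneous cores\<close>

theorem theorem3p4:
  fixes s t :: nat
  assumes "0 < s" and "0 < t" and "even s" and "odd t" and "coprime s t"
  shows "(\<exists>f. bij_betw f (CS s t)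
            (NE ((int t - 1) div 2) ((int s - 2) div 2) \<union>
             NE ((int t - 3) div 2) ((int s - 2) div 2))) \<and>
         card (CS s t) =
           binom ((int s - 2) div 2 + (int t - 1) div 2) ((int s - 2) div 2) +
           binom ((int s - 2) div 2 + (int t - 3) div 2) ((int s - 2) div 2)"
proof -
  define n where "n = s div 2 - 1"
  define m where "m = t div 2"
  have s: "s = 2 * n + 2" and t: "t = 2 * m + 1"
    using assms unfolding n_def m_def by auto
  have params: "(int s - 2) div 2 = int n" "(int t - 1) div 2 = int m" "(int t - 3) div 2 = int m - 1"
    unfolding s t by auto
  let ?b = "if m = 0 then 0 else (n + (m - 1)) choose n"
  have binom: "binom (int n + int m) (int n) = (n + m) choose n" "binom (int n + (int m - 1)) (int n) = ?b"
    by (auto simp: binom_def nat_add_distrib nat_diff_distrib of_nat_diff nat_int_add)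
  have CS: "card (CS s t) = ((n + m) choose n) + ?b \<and> 0 < card (CS s t)"
  proof (cases "m = 0")
    case True
    then have "int t = 1" using t by simp
    then have "{P. core_set (int s) P \<and> core_set (int t) P} = {{}}"
      unfolding \<open>int t = 1\<close> core_set_1_iff by (auto simp: core_set_def)
    moreover have "card (CS s t) = card {P. core_set (int s) P \<and> core_set (int t) P}"
      using \<open>int t = 1\<close> by (intro card_CS_eq_card_core_sets assms) (auto simp: core_set_1_iff)
    ultimately show ?thesis using True by simp
  next
    case False
    interpret coprime_even_odd n m "int s" "int t"
    proof
      show "coprime (int s) (int t)"
        using assms(5) by simp
    qed (use False s t in auto)
    have "card (CS s t) = card {P. core_set (int s) P \<and> core_set (int t) P}"
      by (intro card_CS_eq_card_core_sets assms finite_simultaneous_core)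
    then show ?thesis
      using False card_simultaneous_cores by simp
  qed
  let ?N = "NE (int m) (int n)" and ?N' = "NE (int m - 1) (int n)"
  have N: "finite ?N" "card ?N = (n + m) choose n"
    using finite_card_NE[of m n] by (simp_all add: add.commute)
  have N': "finite ?N' \<and> card ?N' = ?b"
    using finite_card_NE[of "m - 1" n] by (cases m) (simp_all add: add.commute NE_negative)
  have "?N \<inter> ?N' = {}" by (auto simp: NE_def)
  then have "finite (?N \<union> ?N')" "card (?N \<union> ?N') = card (CS s t)"
    using N N' CS by (simp_all add: card_Un_disjoint)
  moreover have "finite (CS s t)" using CS card_gt_0_iff by blast
  ultimately have "\<exists>f. bij_betw f (CS s t) (?N \<union> ?N')"
    by (metis finite_same_card_bij)
  then show ?thesis
    using CS unfolding params binom by blast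
qed

end
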